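(* Let $n$ be a nonnegative integer and let $k,a$ be complex numbers with $k\neq-1$ such that all the functions below are defined. Then $$\sum _{p=0}^n \left(2^p\right)^{1+k} \left(-\zeta \left(-k,3\cdot 2^{-p} a\right)+3^k \left(\zeta \left(-k,2^{-p} a\right)+\zeta \left(-k,\tfrac{1}{6}+2^{-p} a\right)+\zeta \left(-k,\tfrac{5}{6}+2^{-p} a\right)\right)\right)$$ $$=2^{-k} \left(-3^k \zeta (-k,2 a)+\zeta (-k,6 a)+2^{1+k+n} \left(2^n\right)^k \left(3^k \zeta \left(-k,2^{-n} a\right)-\zeta \left(-k,3\cdot 2^{-n} a\right)\right)\right).$$
   Context: $\zeta(s,v)$ is the Hurwitz zeta function, $\zeta(s,v)=\sum_{j=0}^\infty (j+v)^{-s}$ for $\operatorname{Re}s>1$, $v\notin\{0,-1,-2,\dots\}$, continued analytically in $s$ to $\mathbb{C}\setminus\{1\}$. Powers are principal values. *)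

theory Defs
  imports "HOL-Complex_Analysis.Complex_Analysis"
begin

text \<open>
  The plane without \<open>1\<close> is connected, so a function with this property is determined by
  \<open>v\<close> up to its (irrelevant) value at the pole \<open>1\<close>.
\<close>

definition hurwitz_continuation :: "complex \<Rightarrow> (complex \<Rightarrow> complex) \<Rightarrow> bool" where
  "hurwitz_continuation v f \<longleftrightarrow>
     f holomorphic_on (- {1}) \<and>
     (\<forall>s. Re s > 1 \<longrightarrow> (\<lambda>j. (of_nat j + v) powr (- s)) sums f s)"

text \<open>
  For \<open>v\<close> not a nonpositive integer the continuation exists, so
  \<open>hurwitz_zeta s v\<close> is then well determined for all \<open>s \<noteq> 1\<close>. For other arguments
  the value carries no meaning.
\<close>

definition hurwitz_zeta :: "complex \<Rightarrow> complex \<Rightarrow> complex" where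
  "hurwitz_zeta s v = (SOME f. hurwitz_continuation v f) s"

end

theory Submission
  imports Defs
begin

text \<open>
  Write \<open>Z v\<close> for \<open>hurwitz_zeta (- k) v\<close> and \<open>F x = Z (3 x) - 3 powr k * Z x\<close>. The
  multiplication formula \<open>Z (m v) = m powr k * (\<Sum>r<m. Z (v + r / m))\<close> for \<open>m = 2, 3, 6\<close> expresses
  the values of \<open>Z\<close> at \<open>2 b\<close>, \<open>3 b\<close>, \<open>6 b\<close> by those at the six points \<open>b + r / 6\<close>. Eliminating
  \<open>r = 2, 3, 4\<close>, the bracket in the summand with \<open>b = a / 2 ^ p\<close> becomes
  \<open>2 powr (- k) * F (2 b) - 2 * F b\<close>. As \<open>2 b = a / 2 ^ (p - 1)\<close>, the factor
  \<open>(2 ^ p) powr (1 + k)\<close> makes the sum telescope (\<open>sum_halving_telescope\<close>), and only the terms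
  with \<open>F (2 a)\<close> and \<open>F (a / 2 ^ n)\<close> remain.

  The multiplication formula holds for \<open>Re s > 1\<close> by sorting the terms of the series by residue
  modulo \<open>m\<close>, and then for all \<open>s \<noteq> 1\<close> by the identity theorem. This uses that the analytic
  continuation really exists for every complex \<open>v\<close> that is not a nonpositive integer, since otherwise
  the choice in \<open>hurwitz_zeta\<close> says nothing.

  For existence, let \<open>\<xi> s v = (s - 1) * \<zeta>(s, v)\<close>. Since the \<open>v\<close>-derivative of \<open>\<zeta>(s, v)\<close> is
  \<open>- s * \<zeta>(s + 1, v)\<close>, and the mean of \<open>\<zeta>(s, u)\<close> over \<open>u \<in> [v, v + 1]\<close> telescopes to
  \<open>v powr (1 - s) / (s - 1)\<close>, one gets
  \<open>\<xi> s v = v powr (1 - s) + (s - 1) * \<integral> (1 - t) * \<xi> (s + 1) (v + t) dt\<close>, with \<open>t\<close> from \<open>0\<close> to \<open>1\<close>.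
  The right-hand side uses \<open>\<xi>\<close> only one unit further to the right and has no pole, so each
  application of the formula enlarges the half-plane of definition by a strip of width one.
\<close>

section \<open>Contour integrals depending on a parameter\<close>

lemma continuous_on_contour_integral_linepath:
  fixes f :: "'a::topological_space \<Rightarrow> complex \<Rightarrow> complex"
  assumes "continuous_on (U \<times> closed_segment a b) (\<lambda>(x, t). f x t)"
  shows "continuous_on U (\<lambda>x. contour_integral (linepath a b) (f x))"
proof -
  have "continuous_on (U \<times> cbox (0::real) 1) (\<lambda>(x, r). f x (linepath a b r) * (b - a))"
  proof -
    have "continuous_on (U \<times> cbox (0::real) 1) (\<lambda>p. (\<lambda>(x, t). f x t) (fst p, linepath a b (snd p)))"
      by (rule continuous_on_compose2[OF assms])
         (auto simp: linepath_in_path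
           intro!: continuous_intros continuous_on_compose2[OF continuous_on_linepath])
    then show ?thesis
      by (auto simp: case_prod_beta intro!: continuous_intros)
  qed
  from integral_continuous_on_param[OF this] show ?thesis
    by (simp add: contour_integral_integral)
qed

text \<open>
  By Morera's theorem: the two integrations may be interchanged, and each inner integral over a
  triangle vanishes by Cauchy's theorem. In this way joint continuity of \<open>f\<close> suffices, and nothing
  has to be known about its \<open>s\<close>-derivative.
\<close>

lemma holomorphic_on_contour_integral_linepath:
  assumes S: "open S"
    and cont: "continuous_on (S \<times> closed_segment a b) (\<lambda>(s, t). f s t)"
    and hol: "\<And>t. t \<in> closed_segment a b \<Longrightarrow> (\<lambda>s. f s t) holomorphic_on S"
  shows "(\<lambda>s. contour_integral (linepath a b) (f s)) holomorphic_on S"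
proof -
  let ?I = "\<lambda>s. contour_integral (linepath a b) (f s)"
  have "?I analytic_on S"
  proof (rule Morera_triangle[OF _ S], goal_cases)
    case 1
    show ?case by (rule continuous_on_contour_integral_linepath[OF cont])
  next
    case (2 p q r)
    show ?case
    proof
      assume sub: "convex hull {p, q, r} \<subseteq> S"
      have edge: "closed_segment p q \<subseteq> S" "closed_segment q r \<subseteq> S" "closed_segment r p \<subseteq> S"
        using sub segments_subset_convex_hull(1)[of p q r] segments_subset_convex_hull(1)[of q r p]
          segments_subset_convex_hull(1)[of r p q]
        by (auto simp: insert_commute)
      have swap: "contour_integral (linepath x y) ?I =
          contour_integral (linepath a b) (\<lambda>t. contour_integral (linepath x y) (\<lambda>s. f s t))"
        if "closed_segment x y \<subseteq> S" for x y
        by (rule contour_integral_swap)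
           (auto intro!: continuous_on_subset[OF cont] simp: subsetD[OF that])
      have int: "(\<lambda>t. contour_integral (linepath x y) (\<lambda>s. f s t)) contour_integrable_on linepath a b"
        if "closed_segment x y \<subseteq> S" for x y
      proof (rule contour_integrable_continuous_linepath, rule continuous_on_contour_integral_linepath)
        have "continuous_on (closed_segment a b \<times> closed_segment x y)
               (\<lambda>p. (\<lambda>(s, t). f s t) (snd p, fst p))"
          by (rule continuous_on_compose2[OF cont]) (use that in \<open>auto intro!: continuous_intros\<close>)
        then show "continuous_on (closed_segment a b \<times> closed_segment x y) (\<lambda>(t, s). f s t)"
          by (simp add: case_prod_beta)
      qed
      have zero: "contour_integral (linepath p q) (\<lambda>s. f s t) +
            contour_integral (linepath q r) (\<lambda>s. f s t) +
            contour_integral (linepath r p) (\<lambda>s. f s t) = 0" if "t \<in> closed_segment a b" for t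
        by (rule has_chain_integral_chain_integral3, rule Cauchy_theorem_triangle)
           (rule holomorphic_on_subset[OF hol[OF that] sub])
      have "contour_integral (linepath p q) ?I + contour_integral (linepath q r) ?I +
            contour_integral (linepath r p) ?I =
          contour_integral (linepath a b) (\<lambda>t. contour_integral (linepath p q) (\<lambda>s. f s t) +
            contour_integral (linepath q r) (\<lambda>s. f s t) +
            contour_integral (linepath r p) (\<lambda>s. f s t))"
        using edge by (simp add: swap int contour_integral_add contour_integrable_add)
      also have "\<dots> = contour_integral (linepath a b) (\<lambda>t. 0)"
        by (rule contour_integral_eq) (use zero in auto)
      finally show "contour_integral (linepath p q) ?I + contour_integral (linepath q r) ?I +
            contour_integral (linepath r p) ?I = 0"
        by simp
    qed
  qed
  then show ?thesis by (rule analytic_imp_holomorphic)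
qed

section \<open>The series in its half-plane of convergence\<close>

definition hurwitz_series :: "complex \<Rightarrow> complex \<Rightarrow> complex" where
  "hurwitz_series s v = (\<Sum>j. (of_nat j + v) powr (- s))"

text \<open>
  The bound does not depend on \<open>v\<close>, since \<open>j + v\<close> has real part at least \<open>Suc j\<close> and an argument
  between \<open>- pi\<close> and \<open>pi\<close>. This is why the series is first studied for \<open>Re v > 1\<close>.
\<close>

lemma norm_hurwitz_term_le:
  assumes "Re s \<ge> \<sigma>" "\<sigma> \<ge> 0" "\<bar>Im s\<bar> \<le> R" "Re v > 1"
  shows "norm ((of_nat j + v) powr (- s)) \<le> exp (R * pi) * real (Suc j) powr (- \<sigma>)"
proof -
  let ?z = "of_nat j + v"
  have z: "norm ?z \<ge> real (Suc j)"
    using complex_Re_le_cmod[of ?z] assms(4) by simp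
  have "- Im (- s) * Arg ?z \<le> \<bar>Im s\<bar> * \<bar>Arg ?z\<bar>"
    by (metis abs_ge_self abs_mult abs_minus_cancel uminus_complex.simps(2) minus_minus)
  also have "\<dots> \<le> R * pi"
    using assms(3) Arg_bounded[of ?z] by (intro mult_mono) auto
  finally have 1: "exp (- Im (- s) * Arg ?z) \<le> exp (R * pi)" by simp
  have "norm ?z powr Re (- s) \<le> norm ?z powr (- \<sigma>)"
    using z assms(1) by (intro powr_mono) auto
  also have "\<dots> \<le> real (Suc j) powr (- \<sigma>)"
    using z assms(2) by (intro powr_mono2') auto
  finally have "norm ?z powr Re (- s) * exp (- Im (- s) * Arg ?z) \<le>
      real (Suc j) powr (- \<sigma>) * exp (R * pi)"
    using 1 by (intro mult_mono) auto
  then show ?thesis unfolding norm_powr_complex by (simp add: mult.commute)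
qed

lemma uniform_limit_hurwitz_series:
  assumes "\<sigma> > 1"
  shows "uniform_limit {(s, v). \<sigma> \<le> Re s \<and> \<bar>Im s\<bar> \<le> R \<and> Re v > 1}
    (\<lambda>n (s, v). \<Sum>j<n. (of_nat j + v) powr (- s)) (\<lambda>(s, v). hurwitz_series s v) sequentially"
proof -
  have sm: "summable (\<lambda>j. exp (R * pi) * real (Suc j) powr (- \<sigma>))"
    using assms summable_real_powr_iff[of "-\<sigma>"]
    by (intro summable_mult) (subst summable_Suc_iff[of "\<lambda>j. real j powr (- \<sigma>)"], simp)
  have "uniform_limit {(s, v). \<sigma> \<le> Re s \<and> \<bar>Im s\<bar> \<le> R \<and> Re v > 1}
    (\<lambda>n x. \<Sum>j<n. (of_nat j + snd x) powr (- fst x)) (\<lambda>x. \<Sum>j. (of_nat j + snd x) powr (- fst x)) sequentially"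
    by (rule Weierstrass_m_test[OF _ sm]) (use assms norm_hurwitz_term_le in auto)
  then show ?thesis by (simp add: case_prod_unfold hurwitz_series_def)
qed

lemma sums_hurwitz_series:
  assumes "Re s > 1" "Re v > 1"
  shows "(\<lambda>j. (of_nat j + v) powr (- s)) sums hurwitz_series s v"
  unfolding sums_def
  using tendsto_uniform_limitI[OF uniform_limit_hurwitz_series[OF assms(1), of "\<bar>Im s\<bar>"], of "(s, v)"] assms
  by simp

text \<open>
  Joint continuity in \<open>s\<close> and \<open>v\<close> is needed because the recursion integrates over \<open>v\<close>. The domain is
  covered by open sets on each of which the uniform bound applies.
\<close>

lemma continuous_on_hurwitz_series:
  "continuous_on ({s. Re s > 1} \<times> {v. Re v > 1}) (\<lambda>(s, v). hurwitz_series s v)"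
proof -
  define W where "W = (\<lambda>(\<sigma>::real, R::real). {s. Re s > \<sigma> \<and> \<bar>Im s\<bar> < R} \<times> {v. Re v > 1})"
  have op: "open (W x)" for x
  proof -
    have "open {s. Re s > fst x \<and> \<bar>Im s\<bar> < snd x}"
      by (intro open_Collect_conj open_Collect_less continuous_intros)
    then show ?thesis
      unfolding W_def by (auto simp: case_prod_beta open_halfspace_Re_gt intro!: open_Times)
  qed
  have un: "{s. Re s > 1} \<times> {v. Re v > 1} = (\<Union>x\<in>{(\<sigma>, R). \<sigma> > 1}. W x)"
  proof (rule set_eqI)
    fix p :: "complex \<times> complex"
    obtain s v where p: "p = (s, v)" by fastforce
    have "p \<in> W ((1 + Re s) / 2, \<bar>Im s\<bar> + 1)" if "Re s > 1" "Re v > 1"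
      using that by (auto simp: W_def p)
    moreover have "(1 + Re s) / 2 > 1" if "Re s > 1" using that by simp
    ultimately show "p \<in> {s. Re s > 1} \<times> {v. Re v > 1} \<longleftrightarrow> p \<in> (\<Union>x\<in>{(\<sigma>, R). \<sigma> > 1}. W x)"
      by (fastforce simp: p W_def)
  qed
  have cW: "continuous_on (W x) (\<lambda>(s, v). hurwitz_series s v)" if "x \<in> {(\<sigma>, R). \<sigma> > 1}" for x
  proof (rule uniform_limit_theorem)
    show "uniform_limit (W x) (\<lambda>n (s, v). \<Sum>j<n. (of_nat j + v) powr (- s))
            (\<lambda>(s, v). hurwitz_series s v) sequentially"
      by (rule uniform_limit_on_subset[OF uniform_limit_hurwitz_series[of "fst x" "snd x"]])
         (use that in \<open>auto simp: W_def\<close>)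
    show "\<forall>\<^sub>F n in sequentially. continuous_on (W x) (\<lambda>(s, v). \<Sum>j<n. (of_nat j + v) powr (- s))"
      unfolding case_prod_beta W_def
      by (intro always_eventually allI continuous_intros) (auto simp: complex_eq_iff)
  qed auto
  show ?thesis unfolding un by (rule continuous_on_open_UN[OF op cW])
qed

lemma holomorphic_on_hurwitz_series:
  assumes "Re v > 1"
  shows "(\<lambda>s. hurwitz_series s v) holomorphic_on {s. Re s > 1}"
proof (rule holomorphic_uniform_sequence[OF open_halfspace_Re_gt])
  have nz: "of_nat j + v \<noteq> 0" for j using assms by (auto simp: complex_eq_iff)
  then show "(\<lambda>s. \<Sum>j<n. (of_nat j + v) powr (- s)) holomorphic_on {s. Re s > 1}" for n
    by (intro holomorphic_intros)
  fix s assume s: "s \<in> {s. Re s > 1}"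
  define d where "d = (Re s - 1) / 2"
  have d: "d > 0" using s by (simp add: d_def)
  have b: "Re z \<ge> 1 + d \<and> \<bar>Im z\<bar> \<le> \<bar>Im s\<bar> + d" if "z \<in> cball s d" for z
    using that abs_Re_le_cmod[of "s - z"] abs_Im_le_cmod[of "s - z"]
    by (auto simp: dist_norm d_def field_simps)
  have "uniform_limit (cball s d) (\<lambda>n x. \<Sum>j<n. (of_nat j + v) powr - x)
            (\<lambda>s. hurwitz_series s v) sequentially"
    using uniform_limit_compose'[OF uniform_limit_hurwitz_series[of "1 + d" "\<bar>Im s\<bar> + d"],
        of "\<lambda>z. (z, v)" "cball s d"] b d assms by (auto simp: Pi_def)
  moreover have "cball s d \<subseteq> {s. Re s > 1}" using b d by fastforce
  ultimately show "\<exists>d>0. cball s d \<subseteq> {s. Re s > 1} \<and>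
      uniform_limit (cball s d) (\<lambda>n x. \<Sum>j<n. (of_nat j + v) powr - x)
            (\<lambda>s. hurwitz_series s v) sequentially"
    using d by blast
qed


section \<open>A recursion that extends the half-plane\<close>

lemma Re_closed_segment_0_1:
  assumes "t \<in> closed_segment 0 (1::complex)"
  shows "0 \<le> Re t"
  using assms by (auto simp: closed_segment_def)

text \<open>
  Integrating \<open>(1 - t) * s * (x + t) powr (- s - 1)\<close> by parts over \<open>[0, 1]\<close> gives \<open>x powr (- s)\<close>
  plus \<open>(x powr (1 - s) - (x + 1) powr (1 - s)) / (1 - s)\<close>. For \<open>x = j + v\<close> the latter telescopes
  in the sum over \<open>j\<close>. The factor \<open>s * hurwitz_series (s + 1)\<close> is \<open>(s - 1) * hurwitz_series s\<close>
  moved by one, so this is the formula by which \<open>(s - 1) * hurwitz_series s v\<close> will be continued.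
\<close>

lemma hurwitz_series_recursion:
  assumes s: "Re s > 1" and v: "Re v > 1"
  shows "v powr (1 - s) + (s - 1) * contour_integral (linepath 0 1)
           (\<lambda>t. (1 - t) * (s * hurwitz_series (s + 1) (v + t))) = (s - 1) * hurwitz_series s v"
proof -
  let ?g = "linepath 0 (1::complex)"
  define F where "F = (\<lambda>n t. \<Sum>j<n. (of_nat j + (v + t)) powr (- (s + 1)))"
  have s1: "s \<noteq> 1" using s by auto
  define c where "c = 1 / (1 - s)"
  have c: "c * (1 - s) = 1" using s1 by (simp add: c_def)
  have tint: "((\<lambda>t. (1 - t) * (s * (of_nat j + (v + t)) powr (- (s + 1)))) has_contour_integral
      (of_nat j + v) powr (- s) + c * ((of_nat j + v) powr (1 - s) - (of_nat (Suc j) + v) powr (1 - s))) ?g"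
    for j
  proof -
    \<comment> \<open>integration by parts gives this primitive\<close>
    define P where "P = (\<lambda>t. - (1 - t) * (of_nat j + (v + t)) powr (- s)
                          - c * (of_nat j + (v + t)) powr (1 - s))"
    have "((\<lambda>t. (1 - t) * (s * (of_nat j + (v + t)) powr (- (s + 1)))) has_contour_integral
        P (pathfinish ?g) - P (pathstart ?g)) ?g"
    proof (rule contour_integral_primitive[where f = P and S = "closed_segment 0 1"])
      fix t assume "t \<in> closed_segment 0 (1::complex)"
      then have nn: "of_nat j + (v + t) \<notin> \<real>\<^sub>\<le>\<^sub>0"
        using v Re_closed_segment_0_1[of t] by (auto simp: complex_nonpos_Reals_iff)
      have D: "(P has_field_derivative (of_nat j + (v + t)) powr (- s) +
          (1 - t) * (s * (of_nat j + (v + t)) powr (- s - 1)) -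
          c * ((1 - s) * (of_nat j + (v + t)) powr (1 - s - 1))) (at t)"
        unfolding P_def by (rule derivative_eq_intros refl nn)+ (simp add: algebra_simps)
      have cancel: "c * ((1 - s) * (of_nat j + (v + t)) powr (1 - s - 1)) = (of_nat j + (v + t)) powr (- s)"
        using c by (simp add: mult.assoc[symmetric])
      show "(P has_field_derivative (1 - t) * (s * (of_nat j + (v + t)) powr (- (s + 1))))
              (at t within closed_segment 0 1)"
        by (rule has_field_derivative_at_within, rule DERIV_cong[OF D]) (simp only: cancel, simp)
    next
      show "valid_path ?g" by (rule valid_path_linepath)
      show "path_image ?g \<subseteq> closed_segment 0 1" by (simp only: path_image_linepath order_refl)
    qed
    also have "P (pathfinish ?g) - P (pathstart ?g) =
        (of_nat j + v) powr (- s) + c * ((of_nat j + v) powr (1 - s) - (of_nat (Suc j) + v) powr (1 - s))"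
    proof -
      have "of_nat j + (v + 1) = of_nat (Suc j) + v" by simp
      then have "P 1 = - c * (of_nat (Suc j) + v) powr (1 - s)" by (simp only: P_def) simp
      moreover have "P 0 = - ((of_nat j + v) powr (- s)) - c * (of_nat j + v) powr (1 - s)"
        by (simp add: P_def)
      ultimately show ?thesis by (simp add: right_diff_distrib)
    qed
    finally show ?thesis .
  qed
  have Re_vt: "Re (v + t) > 1" if "t \<in> closed_segment 0 1" for t
    using v Re_closed_segment_0_1[OF that] by simp
  have "uniform_limit (closed_segment 0 1)
      (\<lambda>n t. (\<lambda>(s, v). \<Sum>j<n. (of_nat j + v) powr (- s)) (s + 1, v + t))
      (\<lambda>t. (\<lambda>(s, v). hurwitz_series s v) (s + 1, v + t)) sequentially"
  proof (rule uniform_limit_compose'[OF uniform_limit_hurwitz_series])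
    show "1 < Re s" by (fact s)
    show "(\<lambda>t. (s + 1, v + t)) \<in> closed_segment 0 1 \<rightarrow>
            {(z, w). Re s \<le> Re z \<and> \<bar>Im z\<bar> \<le> \<bar>Im s\<bar> \<and> Re w > 1}"
      using Re_vt by (intro Pi_I) simp
  qed
  then have ulF: "uniform_limit (closed_segment 0 1) F (\<lambda>t. hurwitz_series (s + 1) (v + t)) sequentially"
    by (simp only: F_def case_prod_conv)
  have cF: "continuous_on (closed_segment 0 1) (F n)" for n
    unfolding F_def using Re_vt
    by (intro continuous_intros) (fastforce simp: complex_eq_iff)+
  have "continuous_on (closed_segment 0 1) (\<lambda>t. hurwitz_series (s + 1) (v + t))"
    by (rule uniform_limit_theorem[OF _ ulF]) (auto simp: cF)
  then have bd: "bounded ((\<lambda>t. hurwitz_series (s + 1) (v + t)) ` closed_segment 0 1)"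
    by (intro compact_imp_bounded compact_continuous_image) auto
  have bd1: "bounded ((\<lambda>t. (1 - t) * s) ` closed_segment 0 1)"
    by (intro compact_imp_bounded compact_continuous_image continuous_intros) auto
  have "uniform_limit (closed_segment 0 1) (\<lambda>n t. ((1 - t) * s) * F n t)
          (\<lambda>t. ((1 - t) * s) * hurwitz_series (s + 1) (v + t)) sequentially"
    by (rule uniform_lim_mult[OF uniform_limit_const ulF bd1 bd])
  then have ul: "uniform_limit (path_image ?g) (\<lambda>n t. \<Sum>j<n. (1 - t) * (s * (of_nat j + (v + t)) powr (- (s + 1))))
          (\<lambda>t. (1 - t) * (s * hurwitz_series (s + 1) (v + t))) sequentially"
    by (simp add: F_def sum_distrib_left mult.assoc)
  have "(\<lambda>n. contour_integral ?g (\<lambda>t. \<Sum>j<n. (1 - t) * (s * (of_nat j + (v + t)) powr (- (s + 1)))))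
      \<longlonglongrightarrow> contour_integral ?g (\<lambda>t. (1 - t) * (s * hurwitz_series (s + 1) (v + t)))"
  proof (rule contour_integral_uniform_limit(2)[OF _ ul, where B = 1])
    show "\<forall>\<^sub>F n in sequentially. (\<lambda>t. \<Sum>j<n. (1 - t) * (s * (of_nat j + (v + t)) powr (- (s + 1))))
            contour_integrable_on ?g"
      by (intro always_eventually allI contour_integrable_sum has_contour_integral_integrable[OF tint]
          finite_lessThan)
    show "norm (vector_derivative ?g (at t)) \<le> 1" if "t \<in> {0..1}" for t
      by (simp only: vector_derivative_linepath_at) simp
  qed (rule valid_path_linepath, simp)
  moreover have "contour_integral ?g (\<lambda>t. \<Sum>j<n. (1 - t) * (s * (of_nat j + (v + t)) powr (- (s + 1)))) =
      (\<Sum>j<n. (of_nat j + v) powr (- s) + c * ((of_nat j + v) powr (1 - s) - (of_nat (Suc j) + v) powr (1 - s)))"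
    for n
    by (rule contour_integral_unique, rule has_contour_integral_sum) (rule finite_lessThan, rule tint)
  ultimately have lim1: "(\<lambda>j. (of_nat j + v) powr (- s) +
        c * ((of_nat j + v) powr (1 - s) - (of_nat (Suc j) + v) powr (1 - s)))
      sums contour_integral ?g (\<lambda>t. (1 - t) * (s * hurwitz_series (s + 1) (v + t)))"
    by (simp only: sums_def)
  have "(\<lambda>j. (of_nat j + v) powr (1 - s)) \<longlonglongrightarrow> 0"
  proof (rule Lim_null_comparison)
    show "\<forall>\<^sub>F j in sequentially. norm ((of_nat j + v) powr (1 - s)) \<le>
        exp (\<bar>Im s\<bar> * pi) * real (Suc j) powr (- (Re s - 1))"
      using norm_hurwitz_term_le[of "Re s - 1" "s - 1" "\<bar>Im s\<bar>" v] s v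
      by (intro always_eventually) simp
    have "(\<lambda>j. real (Suc j) powr (- (Re s - 1))) \<longlonglongrightarrow> 0"
      by (rule tendsto_neg_powr) (use s filterlim_compose[OF filterlim_real_sequentially filterlim_Suc] in simp_all)
    then show "(\<lambda>j. exp (\<bar>Im s\<bar> * pi) * real (Suc j) powr (- (Re s - 1))) \<longlonglongrightarrow> 0"
      by (rule tendsto_mult_right_zero)
  qed
  from telescope_sums'[OF this] have "(\<lambda>j. (of_nat j + v) powr (- s) +
        c * ((of_nat j + v) powr (1 - s) - (of_nat (Suc j) + v) powr (1 - s)))
      sums (hurwitz_series s v + c * (v powr (1 - s) - 0))"
    by (intro sums_add sums_mult sums_hurwitz_series s v) simp
  from sums_unique2[OF lim1 this]
  have integral: "contour_integral ?g (\<lambda>t. (1 - t) * (s * hurwitz_series (s + 1) (v + t))) =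
      hurwitz_series s v + c * (v powr (1 - s) - 0)" .
  have "(s - 1) * c = - 1" using c by algebra
  then have "p + (s - 1) * (h + c * (p - 0)) = (s - 1) * h" for p h
    by algebra
  then show ?thesis unfolding integral .
qed

text \<open>
  \<open>hurwitz_xi N s v\<close> is the continuation of \<open>(s - 1) * \<zeta>(s, v)\<close> to \<open>Re s > 1 - N\<close>, for \<open>Re v > 1\<close>.
\<close>

primrec hurwitz_xi :: "nat \<Rightarrow> complex \<Rightarrow> complex \<Rightarrow> complex" where
  "hurwitz_xi 0 s v = (s - 1) * hurwitz_series s v"
| "hurwitz_xi (Suc N) s v = v powr (1 - s) +
     (s - 1) * contour_integral (linepath 0 1) (\<lambda>t. (1 - t) * hurwitz_xi N (s + 1) (v + t))"

lemma continuous_on_hurwitz_xi: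
  "continuous_on ({s. Re s > 1 - real N} \<times> {v. Re v > 1}) (\<lambda>(s, v). hurwitz_xi N s v)"
proof (induction N)
  case 0
  show ?case using continuous_on_hurwitz_series
    by (auto simp: case_prod_unfold intro!: continuous_intros)
next
  case (Suc N)
  let ?U = "{s. Re s > 1 - real (Suc N)} \<times> {v. Re v > 1}"
  have "continuous_on (?U \<times> closed_segment 0 1)
      (\<lambda>q. (\<lambda>(s, v). hurwitz_xi N s v) (fst (fst q) + 1, snd (fst q) + snd q))"
    by (rule continuous_on_compose2[OF Suc.IH])
       (auto intro!: continuous_intros dest!: Re_closed_segment_0_1)
  then have "continuous_on (?U \<times> closed_segment 0 1)
      (\<lambda>(p, t). (1 - t) * hurwitz_xi N (fst p + 1) (snd p + t))"
    by (auto simp: case_prod_unfold intro!: continuous_intros)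
  from continuous_on_contour_integral_linepath[OF this]
  show ?case
    by (auto simp: case_prod_unfold intro!: continuous_intros)
qed

lemma holomorphic_on_hurwitz_xi:
  "Re v > 1 \<Longrightarrow> (\<lambda>s. hurwitz_xi N s v) holomorphic_on {s. Re s > 1 - real N}"
proof (induction N arbitrary: v)
  case 0
  then show ?case using holomorphic_on_hurwitz_series
    by (auto intro!: holomorphic_intros)
next
  case (Suc N)
  let ?S = "{s. Re s > 1 - real (Suc N)}"
  have "(\<lambda>s. contour_integral (linepath 0 1) (\<lambda>t. (1 - t) * hurwitz_xi N (s + 1) (v + t)))
      holomorphic_on ?S"
  proof (rule holomorphic_on_contour_integral_linepath[OF open_halfspace_Re_gt])
    have "continuous_on (?S \<times> closed_segment 0 1)
        (\<lambda>q. (\<lambda>(s, v). hurwitz_xi N s v) (fst q + 1, v + snd q))"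
      by (rule continuous_on_compose2[OF continuous_on_hurwitz_xi])
         (use Suc.prems in \<open>auto intro!: continuous_intros dest!: Re_closed_segment_0_1\<close>)
    then show "continuous_on (?S \<times> closed_segment 0 1) (\<lambda>(s, t). (1 - t) * hurwitz_xi N (s + 1) (v + t))"
      by (auto simp: case_prod_unfold intro!: continuous_intros)
    fix t :: complex assume "t \<in> closed_segment 0 1"
    then have "Re (v + t) > 1" using Suc.prems Re_closed_segment_0_1[of t] by simp
    then have "((\<lambda>s. hurwitz_xi N s (v + t)) \<circ> (\<lambda>s. s + 1)) holomorphic_on ?S"
      by (intro holomorphic_on_compose_gen[OF _ Suc.IH] holomorphic_intros) auto
    then show "(\<lambda>s. (1 - t) * hurwitz_xi N (s + 1) (v + t)) holomorphic_on ?S"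
      by (auto simp: o_def intro!: holomorphic_intros)
  qed
  then show ?case by (auto intro!: holomorphic_intros)
qed

text \<open>
  Consecutive continuations agree without recourse to the identity theorem: the case \<open>N = 0\<close> is the
  recursion of the series, and the integral defining the next continuation carries the agreement
  one unit to the left.
\<close>

lemma hurwitz_xi_Suc:
  "Re s > 1 - real N \<Longrightarrow> Re v > 1 \<Longrightarrow> hurwitz_xi (Suc N) s v = hurwitz_xi N s v"
proof (induction N arbitrary: s v)
  case 0
  then show ?case using hurwitz_series_recursion[of s v] by simp
next
  case (Suc N)
  have "contour_integral (linepath 0 1) (\<lambda>t. (1 - t) * hurwitz_xi (Suc N) (s + 1) (v + t)) =
        contour_integral (linepath 0 1) (\<lambda>t. (1 - t) * hurwitz_xi N (s + 1) (v + t))"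
    by (rule contour_integral_eq)
       (use Suc in \<open>auto simp del: hurwitz_xi.simps dest!: Re_closed_segment_0_1\<close>)
  then show ?case by (simp only: hurwitz_xi.simps(2))
qed

lemma hurwitz_xi_stable:
  assumes "M \<ge> N" "Re s > 1 - real N" "Re v > 1"
  shows "hurwitz_xi M s v = hurwitz_xi N s v"
  using assms(1)
proof (induction M rule: dec_induct)
  case (step M)
  have "Re s > 1 - real M" using step.hyps assms(2) by simp
  then show ?case using hurwitz_xi_Suc[of M s v] step.IH assms(3) by simp
qed simp

section \<open>Existence and uniqueness of the continuation\<close>

lemma hurwitz_continuation_exists_Re_gt_1:
  assumes "Re v > 1"
  shows "\<exists>f. hurwitz_continuation v f"
proof -
  \<comment> \<open>\<open>N s\<close> is large enough that \<open>s\<close> lies in the half-plane of \<open>hurwitz_xi (N s)\<close>; by stability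
    the choice does not matter, so these pieces glue to an entire function\<close>
  define N where "N = (\<lambda>s. nat \<lceil>2 - Re s\<rceil>)"
  define g where "g = (\<lambda>s. hurwitz_xi (N s) s v)"
  have N: "Re s > 1 - real (N s)" for s
  proof -
    have "real (N s) \<ge> 2 - Re s" unfolding N_def by linarith
    then show ?thesis by simp
  qed
  have g: "g s = hurwitz_xi M s v" if "Re s > 1 - real M" for s M
    unfolding g_def using hurwitz_xi_stable[of M "max M (N s)" s v] that
      hurwitz_xi_stable[of "N s" "max M (N s)" s v] N[of s] assms by simp
  have "g holomorphic_on (\<Union>M. {s. Re s > 1 - real M})"
  proof (rule holomorphic_on_UN_open[OF _ open_halfspace_Re_gt])
    show "g holomorphic_on {s. Re s > 1 - real M}" for M
      using holomorphic_on_hurwitz_xi[OF assms, of M] by (rule holomorphic_transform) (simp add: g)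
  qed
  moreover have "(\<Union>M. {s. Re s > 1 - real M}) = UNIV" using N by blast
  ultimately have hol: "g holomorphic_on UNIV" by simp
  have "(\<lambda>s. g s / (s - 1)) holomorphic_on - {1}"
    by (intro holomorphic_intros holomorphic_on_subset[OF hol]) auto
  moreover have "(\<lambda>j. (of_nat j + v) powr (- s)) sums (g s / (s - 1))" if "Re s > 1" for s
  proof -
    have "s \<noteq> 1" using that by auto
    then have "g s / (s - 1) = hurwitz_series s v" using g[of 0 s] that by simp
    then show ?thesis using sums_hurwitz_series[OF that assms] by simp
  qed
  ultimately show ?thesis unfolding hurwitz_continuation_def by blast
qed

text \<open>
  Splitting off the first terms of the series moves \<open>v\<close> into \<open>Re v > 1\<close>; each of them is entire
  in \<open>s\<close> because \<open>v\<close> is not a nonpositive integer.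
\<close>

lemma hurwitz_continuation_exists:
  assumes "v \<notin> \<int>\<^sub>\<le>\<^sub>0"
  shows "\<exists>f. hurwitz_continuation v f"
proof -
  define m where "m = nat \<lceil>2 - Re v\<rceil>"
  have "Re (v + of_nat m) > 1"
  proof -
    have "real m \<ge> 2 - Re v" unfolding m_def by linarith
    then show ?thesis by simp
  qed
  then obtain f where f: "hurwitz_continuation (v + of_nat m) f"
    using hurwitz_continuation_exists_Re_gt_1 by blast
  let ?g = "\<lambda>s. f s + (\<Sum>j<m. (of_nat j + v) powr (- s))"
  have nz: "of_nat j + v \<noteq> 0" for j
    using assms by (metis add_eq_0_iff nonpos_Ints_of_int of_int_minus of_int_of_nat_eq of_nat_0_le_iff neg_le_0_iff_le)
  have "?g holomorphic_on - {1}"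
    using f nz unfolding hurwitz_continuation_def by (intro holomorphic_intros) auto
  moreover have "(\<lambda>j. (of_nat j + v) powr (- s)) sums ?g s" if "Re s > 1" for s
  proof -
    have "(\<lambda>j. (of_nat (j + m) + v) powr (- s)) sums f s"
      using f that unfolding hurwitz_continuation_def by (simp add: add_ac)
    then show ?thesis by (subst (asm) sums_iff_shift)
  qed
  ultimately show ?thesis unfolding hurwitz_continuation_def by blast
qed

lemma hurwitz_continuation_unique:
  assumes "hurwitz_continuation v f" "hurwitz_continuation v g" "s \<noteq> 1"
  shows "f s = g s"
proof (rule analytic_continuation_open[of "{s. Re s > 1}" "- {1}" f g s])
  show "connected (- {1::complex})" by (rule connected_punctured_universe) simp
  show "{s. Re s > 1} \<noteq> {}" by (auto intro: exI[of "\<lambda>s. Re s > 1" 2])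
  show "f s = g s" if "s \<in> {s. Re s > 1}" for s
    using assms that unfolding hurwitz_continuation_def by (blast intro: sums_unique2)
qed (use assms in \<open>auto simp: hurwitz_continuation_def open_halfspace_Re_gt\<close>)

lemma hurwitz_zeta_eqI:
  assumes "hurwitz_continuation v f" "s \<noteq> 1"
  shows "hurwitz_zeta s v = f s"
  unfolding hurwitz_zeta_def
  by (rule hurwitz_continuation_unique[OF someI[of "hurwitz_continuation v", OF assms(1)] assms])

lemma hurwitz_continuation_hurwitz_zeta:
  assumes "v \<notin> \<int>\<^sub>\<le>\<^sub>0"
  shows "hurwitz_continuation v (\<lambda>s. hurwitz_zeta s v)"
  unfolding hurwitz_zeta_def using someI_ex[OF hurwitz_continuation_exists[OF assms]] by simp

section \<open>The multiplication formula\<close>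

text \<open>
  The right-hand side is a continuation of the series for \<open>of_nat m * v\<close>: the block of terms
  \<open>q * m, ..., q * m + m - 1\<close> of that series is \<open>of_nat m powr (- s)\<close> times the sum of the \<open>q\<close>-th terms
  of the series for \<open>v + r / m\<close>. Principal powers are multiplicative here since \<open>m\<close> is positive.
\<close>

lemma hurwitz_zeta_multiplication:
  assumes "m > 0" and mv: "of_nat m * v \<notin> \<int>\<^sub>\<le>\<^sub>0" and "s \<noteq> 1"
  shows "hurwitz_zeta s (of_nat m * v) =
         of_nat m powr (- s) * (\<Sum>r<m. hurwitz_zeta s (v + of_nat r / of_nat m))"
proof (rule hurwitz_zeta_eqI[OF _ assms(3)])
  have hc: "hurwitz_continuation (v + of_nat r / of_nat m)
              (\<lambda>s. hurwitz_zeta s (v + of_nat r / of_nat m))" for r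
  proof (rule hurwitz_continuation_hurwitz_zeta, rule notI)
    assume "v + of_nat r / of_nat m \<in> \<int>\<^sub>\<le>\<^sub>0"
    then obtain q where q: "v + of_nat r / of_nat m = - of_nat q" by (auto elim: nonpos_Ints_cases')
    have "of_nat m * v = of_nat m * (v + of_nat r / of_nat m) - of_nat r"
      using assms(1) by (simp add: field_simps)
    then have "of_nat m * v = - of_nat (m * q + r)" by (simp add: q)
    then show False using mv by (metis nonpos_Ints_of_int of_int_minus of_int_of_nat_eq of_nat_0_le_iff neg_le_0_iff_le)
  qed
  show "hurwitz_continuation (of_nat m * v)
      (\<lambda>s. of_nat m powr (- s) * (\<Sum>r<m. hurwitz_zeta s (v + of_nat r / of_nat m)))"
    unfolding hurwitz_continuation_def
  proof (intro conjI allI impI)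
    show "(\<lambda>s. of_nat m powr - s * (\<Sum>r<m. hurwitz_zeta s (v + of_nat r / of_nat m))) holomorphic_on - {1}"
      using hc unfolding hurwitz_continuation_def by (intro holomorphic_intros) auto
    fix s :: complex assume s: "Re s > 1"
    let ?t = "\<lambda>j. (of_nat j + of_nat m * v) powr (- s)"
    show "?t sums (of_nat m powr (- s) * (\<Sum>r<m. hurwitz_zeta s (v + of_nat r / of_nat m)))"
    proof -
      have m: "of_nat m \<noteq> (0::complex)" using assms(1) by simp
      \<comment> \<open>grouping a series is valid only once it is known to converge\<close>
      have tot: "?t sums hurwitz_zeta s (of_nat m * v)"
        using hurwitz_continuation_hurwitz_zeta[OF mv] s unfolding hurwitz_continuation_def by blast
      have part: "(\<lambda>q. (of_nat q + (v + of_nat r / of_nat m)) powr (- s)) sums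
          hurwitz_zeta s (v + of_nat r / of_nat m)" for r
        using hc[of r] s unfolding hurwitz_continuation_def by blast
      have block: "sum ?t {q * m..<q * m + m} = of_nat m powr (- s) *
          (\<Sum>r<m. (of_nat q + (v + of_nat r / of_nat m)) powr (- s))" for q
      proof -
        have "sum ?t {q * m..<q * m + m} = (\<Sum>r<m. ?t (r + q * m))"
          using sum.shift_bounds_nat_ivl[of ?t 0 "q * m" m] by (simp add: add.commute lessThan_atLeast0)
        also have "\<dots> = (\<Sum>r<m. of_nat m powr (- s) * (of_nat q + (v + of_nat r / of_nat m)) powr (- s))"
        proof (rule sum.cong[OF refl])
          fix r
          have "of_nat (r + q * m) + of_nat m * v = of_nat m * (of_nat q + (v + of_nat r / of_nat m))"
            using m by (simp add: field_simps)
          then show "?t (r + q * m) = of_nat m powr (- s) * (of_nat q + (v + of_nat r / of_nat m)) powr (- s)"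
            by (simp only: powr_times_real_left[OF Reals_of_nat]) (simp add: powr_times_real_left)
        qed
        finally show ?thesis by (simp add: sum_distrib_left)
      qed
      have split: "(\<lambda>q. sum ?t {q * m..<q * m + m}) sums
          (of_nat m powr (- s) * (\<Sum>r<m. hurwitz_zeta s (v + of_nat r / of_nat m)))"
        unfolding block by (intro sums_mult sums_sum part)
      show ?thesis
        using tot unfolding sums_unique2[OF sums_group[OF tot assms(1)] split] .
    qed
  qed
qed

section \<open>The telescoping sum\<close>

lemma two_power_powr:
  "(2 ^ p) powr (z::complex) = (2 powr z) ^ p"
  by (induction p) (simp_all add: powr_times_real_left)

text \<open>
  With \<open>T = 2 powr k\<close>, the value \<open>2 * (2 * T) ^ p * F (a / 2 ^ p)\<close> is subtracted in the
  \<open>p\<close>-th summand and added again in the next one, because the argument is halved at each step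
  while the weight grows by \<open>2 * T\<close>.
\<close>

lemma sum_halving_telescope:
  fixes F :: "complex \<Rightarrow> complex"
  assumes "T \<noteq> 0"
  shows "(\<Sum>p = 0..n. (2 * T) ^ p * (F (2 * (a / 2 ^ p)) / T - 2 * F (a / 2 ^ p))) =
         F (2 * a) / T - 2 * (2 * T) ^ n * F (a / 2 ^ n)"
proof (induction n)
  case (Suc n)
  have half: "2 * (a / 2 ^ Suc n) = a / 2 ^ n" by simp
  have "(2 * T) ^ Suc n * (x / T - 2 * y) = 2 * (2 * T) ^ n * x - 2 * (2 * T) ^ Suc n * y" for x y
    using assms by (simp add: right_diff_distrib)
  then show ?case
    by (simp only: sum.atLeast0_atMost_Suc Suc.IH half) simp
qed simp

theorem theorem4p156:
  fixes n :: nat and k a :: complex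
  assumes "k \<noteq> - 1"
    and "\<And>p. p \<le> n \<Longrightarrow> 3 * (a / 2 ^ p) \<notin> \<int>\<^sub>\<le>\<^sub>0"
    and "\<And>p. p \<le> n \<Longrightarrow> a / 2 ^ p \<notin> \<int>\<^sub>\<le>\<^sub>0"
    and "\<And>p. p \<le> n \<Longrightarrow> 1 / 6 + a / 2 ^ p \<notin> \<int>\<^sub>\<le>\<^sub>0"
    and "\<And>p. p \<le> n \<Longrightarrow> 5 / 6 + a / 2 ^ p \<notin> \<int>\<^sub>\<le>\<^sub>0"
    and "2 * a \<notin> \<int>\<^sub>\<le>\<^sub>0"
    and "6 * a \<notin> \<int>\<^sub>\<le>\<^sub>0"
  shows "(\<Sum>p = 0..n. (2 ^ p) powr (1 + k) *
            (- hurwitz_zeta (- k) (3 * (a / 2 ^ p)) +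
             3 powr k * (hurwitz_zeta (- k) (a / 2 ^ p) +
                         hurwitz_zeta (- k) (1 / 6 + a / 2 ^ p) +
                         hurwitz_zeta (- k) (5 / 6 + a / 2 ^ p)))) =
         2 powr (- k) *
           (- (3 powr k) * hurwitz_zeta (- k) (2 * a) + hurwitz_zeta (- k) (6 * a) +
            2 powr (1 + k + of_nat n) * (2 ^ n) powr k *
              (3 powr k * hurwitz_zeta (- k) (a / 2 ^ n) -
               hurwitz_zeta (- k) (3 * (a / 2 ^ n))))"
proof -
  define Z where "Z = hurwitz_zeta (- k)"
  define F where "F = (\<lambda>x. Z (3 * x) - 3 powr k * Z x)"
  define T where "T = 2 powr k"
  have T: "T \<noteq> 0" by (simp add: T_def)
  have k: "- k \<noteq> 1" using assms(1) by (metis minus_minus)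
  have six: "6 powr k = T * 3 powr k"
    using powr_times_real_left[of 2 3 k] by (simp add: T_def)
  \<comment> \<open>\<open>2 b\<close> and \<open>6 b\<close> are the points \<open>b\<close> and \<open>3 b\<close> of the previous summand, except for \<open>p = 0\<close>,
    which the hypotheses on \<open>2 * a\<close> and \<open>6 * a\<close> cover\<close>
  have b26: "2 * (a / 2 ^ p) \<notin> \<int>\<^sub>\<le>\<^sub>0 \<and> 6 * (a / 2 ^ p) \<notin> \<int>\<^sub>\<le>\<^sub>0" if "p \<le> n" for p
    using assms(2,3)[of "p - 1"] assms(6,7) that by (cases p) auto
  have "(\<Sum>p = 0..n. (2 ^ p) powr (1 + k) * (- Z (3 * (a / 2 ^ p)) +
            3 powr k * (Z (a / 2 ^ p) + Z (1 / 6 + a / 2 ^ p) + Z (5 / 6 + a / 2 ^ p)))) =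
        (\<Sum>p = 0..n. (2 * T) ^ p * (F (2 * (a / 2 ^ p)) / T - 2 * F (a / 2 ^ p)))"
  proof (rule sum.cong[OF refl])
    fix p assume "p \<in> {0..n}"
    then have p: "p \<le> n" by simp
    define b where "b = a / 2 ^ p"
    have Z6: "Z (6 * b) = T * 3 powr k *
        (Z b + Z (b + 1/6) + Z (b + 1/3) + Z (b + 1/2) + Z (b + 2/3) + Z (b + 5/6))"
      using hurwitz_zeta_multiplication[of 6 b "- k"] b26[OF p] k six
      by (simp add: Z_def b_def eval_nat_numeral lessThan_Suc add_ac)
    have Z3: "Z (3 * b) = 3 powr k * (Z b + Z (b + 1/3) + Z (b + 2/3))"
      using hurwitz_zeta_multiplication[of 3 b "- k"] assms(2)[OF p] k
      by (simp add: Z_def b_def eval_nat_numeral lessThan_Suc add_ac)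
    have Z2: "Z (2 * b) = T * (Z b + Z (b + 1/2))"
      using hurwitz_zeta_multiplication[of 2 b "- k"] b26[OF p] k
      by (simp add: Z_def b_def T_def eval_nat_numeral lessThan_Suc add_ac)
    have F2: "F (2 * b) = Z (6 * b) - 3 powr k * Z (2 * b)" by (simp add: F_def mult.assoc[symmetric])
    have F1: "F b = Z (3 * b) - 3 powr k * Z b" by (simp add: F_def)
    \<comment> \<open>\<open>zr\<close> stands for the value at \<open>b + r / 6\<close>\<close>
    have alg: "- (c * (z0 + z2 + z4)) + c * (z0 + z1 + z5) =
        (T * c * (z0 + z1 + z2 + z3 + z4 + z5) - c * (T * (z0 + z3))) / T - 2 * (c * (z0 + z2 + z4) - c * z0)"
      for c z0 z1 z2 z3 z4 z5
      using T by (simp add: field_simps)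
    have "- Z (3 * b) + 3 powr k * (Z b + Z (1 / 6 + b) + Z (5 / 6 + b)) = F (2 * b) / T - 2 * F b"
      unfolding F2 Z6 Z2 F1 Z3 add.commute[of "1 / 6" b] add.commute[of "5 / 6" b]
      by (rule alg)
    moreover have "(2 ^ p) powr (1 + k) = (2 * T) ^ p"
      by (simp add: two_power_powr T_def powr_add)
    ultimately show "(2 ^ p) powr (1 + k) * (- Z (3 * (a / 2 ^ p)) +
            3 powr k * (Z (a / 2 ^ p) + Z (1 / 6 + a / 2 ^ p) + Z (5 / 6 + a / 2 ^ p))) =
        (2 * T) ^ p * (F (2 * (a / 2 ^ p)) / T - 2 * F (a / 2 ^ p))"
      by (simp add: b_def)
  qed
  also have "\<dots> = F (2 * a) / T - 2 * (2 * T) ^ n * F (a / 2 ^ n)"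
    by (rule sum_halving_telescope[OF T])
  also have "\<dots> = 2 powr (- k) *
           (- (3 powr k) * Z (2 * a) + Z (6 * a) +
            2 powr (1 + k + of_nat n) * (2 ^ n) powr k *
              (3 powr k * Z (a / 2 ^ n) - Z (3 * (a / 2 ^ n))))"
  proof -
    have pn: "2 powr (1 + k + of_nat n) * (2 ^ n) powr k = T * (2 * (2 * T) ^ n)"
      by (simp add: two_power_powr powr_add T_def power_mult_distrib)
    have "F (2 * a) / T - X * F y = inverse T *
        (- (3 powr k) * Z (2 * a) + Z (6 * a) + T * X * (3 powr k * Z y - Z (3 * y)))" for X y
      using T by (simp add: F_def field_simps)
    then show ?thesis unfolding pn by (simp only: powr_minus T_def)
  qed
  finally show ?thesis by (simp only: Z_def)
qed

end
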